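(* Every Cartesian system over $\mathbb N_0$ is isomorphic to a word system (over some alphabet), the latter being regarded as a Cartesian system via the unique factorization of words.
   Context: A Cartesian system over $\mathbb N_0$ is a family $(X_n)_{n\in\mathbb N_0}$ of sets with $X_0=\{\Lambda\}$ a one-point set, together with injections $i_{m,n}\colon X_{m+n}\to X_m\times X_n$ ($m,n\in\mathbb N_0$) such that, for all $\ell,m,n\in\mathbb N_0$, $$(i_{\ell,m}\times \mathrm{id}_{X_n})\circ i_{\ell+m,n}=(\mathrm{id}_{X_\ell}\times i_{m,n})\circ i_{\ell,m+n}$$ as maps $X_{\ell+m+n}\to X_\ell\times X_m\times X_n$, and such that $i_{0,n}(x)=(\Lambda,x)$ and $i_{n,0}(x)=(x,\Lambda)$ for all $x\in X_n$. An isomorphism from a Cartesian system $(X_n)$ with injections $i_{m,n}$ to a Cartesian system $(X'_n)$ with injections $i'_{m,n}$ is a family of bijections $\alpha_n\colon X_n\to X'_n$ with $i'_{m,n}\circ\alpha_{m+n}=(\alpha_m\times\alpha_n)\circ i_{m,n}$ for all $m,n\in\mathbb N_0$. An alphabet is a set $A$. $A^n$ is the set of words of length $n$ over $A$ ($n$-tuples), $A^0=\{\Lambda\}$ with $\Lambda=()$ the empty word, and $A^*=\bigcup_{n\in\mathbb N_0}A^n$ is a monoid under concatenation. A word $y$ is a subword of $w$ if $w=xyz$ for some $x,z\in A^*$. A word system over $A$ is a family $(X_n)_{n\in\mathbb N_0}$ of subsets $X_n\subset A^n$ with $X_0=A^0$ such that whenever $w\in\bigcup_n X_n$ and $y\in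 A^k$ is a subword of $w$, then $y\in X_k$. A word system is a Cartesian system with the maps $i_{m,n}\colon X_{m+n}\to X_m\times X_n$ sending $w$ to the unique pair $(x,y)\in A^m\times A^n$ with $w=xy$. *)

theory Defs
  imports "HOL-Library.Sublist" "HOL-Library.FuncSet"
begin

(* Products associate to the right, so the values of (i l m x id) o i (l+m) n have to be
   reassociated before they are compared in X l x (X m x X n). *)
locale cartesian_system =
  fixes X :: "nat \<Rightarrow> 'a set"
    and \<Lambda> :: 'a
    and i :: "nat \<Rightarrow> nat \<Rightarrow> 'a \<Rightarrow> 'a \<times> 'a"
  assumes X_0: "X 0 = {\<Lambda>}"
    and split_in: "i m n \<in> X (m + n) \<rightarrow> X m \<times> X n"
    and split_inj: "inj_on (i m n) (X (m + n))"
    and split_coassoc: "x \<in> X (l + m + n) \<Longrightarrow>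
          (\<lambda>((a, b), c). (a, b, c)) (map_prod (i l m) id (i (l + m) n x))
            = map_prod id (i m n) (i l (m + n) x)"
    and split_left_unit: "x \<in> X n \<Longrightarrow> i 0 n x = (\<Lambda>, x)"
    and split_right_unit: "x \<in> X n \<Longrightarrow> i n 0 x = (x, \<Lambda>)"

locale cartesian_system_iso =
  source: cartesian_system X \<Lambda> i + target: cartesian_system X' \<Lambda>' i'
  for X :: "nat \<Rightarrow> 'a set" and \<Lambda> i
    and X' :: "nat \<Rightarrow> 'b set" and \<Lambda>' i' +
  fixes \<alpha> :: "nat \<Rightarrow> 'a \<Rightarrow> 'b"
  assumes bij: "bij_betw (\<alpha> n) (X n) (X' n)"
    and compat: "x \<in> X (m + n) \<Longrightarrow>
          i' m n (\<alpha> (m + n) x) = map_prod (\<alpha> m) (\<alpha> n) (i m n x)"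

definition cartesian_isomorphic ::
    "(nat \<Rightarrow> 'a set) \<Rightarrow> 'a \<Rightarrow> (nat \<Rightarrow> nat \<Rightarrow> 'a \<Rightarrow> 'a \<times> 'a) \<Rightarrow>
     (nat \<Rightarrow> 'b set) \<Rightarrow> 'b \<Rightarrow> (nat \<Rightarrow> nat \<Rightarrow> 'b \<Rightarrow> 'b \<times> 'b) \<Rightarrow> bool" where
  "cartesian_isomorphic X \<Lambda> i X' \<Lambda>' i' \<longleftrightarrow> (\<exists>\<alpha>. cartesian_system_iso X \<Lambda> i X' \<Lambda>' i' \<alpha>)"

definition words :: "'a set \<Rightarrow> nat \<Rightarrow> 'a list set" where
  "words A n = {w \<in> lists A. length w = n}"

locale word_system =
  fixes A :: "'a set" and W :: "nat \<Rightarrow> 'a list set"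
  assumes W_subset: "W n \<subseteq> words A n"
    and W_0: "W 0 = words A 0"
    and W_subword: "w \<in> (\<Union>n. W n) \<Longrightarrow> y \<in> words A k \<Longrightarrow> sublist y w \<Longrightarrow> y \<in> W k"

definition word_split :: "'a set \<Rightarrow> nat \<Rightarrow> nat \<Rightarrow> 'a list \<Rightarrow> 'a list \<times> 'a list" where
  "word_split A m n w = (THE (x, y). x \<in> words A m \<and> y \<in> words A n \<and> w = x @ y)"

lemma word_split_eq:
  assumes "w \<in> words A (m + n)"
  shows "word_split A m n w = (take m w, drop m w)"
  unfolding word_split_def
proof (rule the_equality)
  show "case (take m w, drop m w) of (x, y) \<Rightarrow> x \<in> words A m \<and> y \<in> words A n \<and> w = x @ y"
    using assms by (auto simp: words_def dest: in_set_takeD in_set_dropD)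
next
  fix p assume "case p of (x, y) \<Rightarrow> x \<in> words A m \<and> y \<in> words A n \<and> w = x @ y"
  then show "p = (take m w, drop m w)"
    by (auto simp: words_def)
qed

lemma (in word_system) in_words: "w \<in> W n \<Longrightarrow> w \<in> words A n"
  using W_subset by blast

lemma (in word_system) take_drop_in:
  assumes "w \<in> W (m + n)"
  shows "take m w \<in> W m" "drop m w \<in> W n"
proof -
  have w: "w \<in> words A (m + n)" using assms by (rule in_words)
  have "take m w \<in> words A m" "drop m w \<in> words A n"
    using w by (auto simp: words_def dest: in_set_takeD in_set_dropD)
  then show "take m w \<in> W m" "drop m w \<in> W n"
    using assms by (auto intro: W_subword)
qed

lemma (in word_system) cartesian: "cartesian_system W [] (word_split A)"
proof
  show "W 0 = {[]}"
    by (auto simp: W_0 words_def)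
  show "word_split A m n \<in> W (m + n) \<rightarrow> W m \<times> W n" for m n
    by (auto simp: word_split_eq in_words take_drop_in)
  show "inj_on (word_split A m n) (W (m + n))" for m n
    by (rule inj_onI) (metis Pair_inject append_take_drop_id in_words word_split_eq)
  show "(\<lambda>((a, b), c). (a, b, c)) (map_prod (word_split A l m) id (word_split A (l + m) n x))
          = map_prod id (word_split A m n) (word_split A l (m + n) x)"
    if x: "x \<in> W (l + m + n)" for x l m n
  proof -
    have x': "x \<in> W (l + (m + n))" using x by (simp add: add.assoc)
    show ?thesis
      using take_drop_in[OF x] take_drop_in[OF x'] in_words[OF x] in_words[OF x']
      by (simp add: word_split_eq in_words drop_take add.commute)
  qed
  show "word_split A 0 n x = ([], x)" if "x \<in> W n" for x n
    using in_words[OF that] by (simp add: word_split_eq)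
  show "word_split A n 0 x = (x, [])" if "x \<in> W n" for x n
    using in_words[OF that] by (simp add: word_split_eq) (simp add: words_def)
qed

end

theory Submission
  imports Defs
begin

text \<open>
  Take \<open>A = X\<^sub>1\<close> and read off the letters of \<open>x \<in> X\<^sub>n\<close> by splitting off the first component of
  \<open>i\<^bsub>1,n-1\<^esub>\<close> repeatedly. Coassociativity shows that this reading turns every \<open>i\<^bsub>m,n\<^esub>\<close> into the
  factorization of words, so the image is closed under subwords; injectivity of \<open>i\<^bsub>1,n-1\<^esub>\<close> makes
  the reading injective.
\<close>

text \<open>The degree \<open>n\<close> is an explicit argument because the sets \<open>X n\<close>
  may overlap, so that \<open>x\<close> alone need not determine it.\<close>

primrec letters :: "(nat \<Rightarrow> nat \<Rightarrow> 'a \<Rightarrow> 'a \<times> 'a) \<Rightarrow> nat \<Rightarrow> 'a \<Rightarrow> 'a list" where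
  "letters i 0 x = []"
| "letters i (Suc n) x = fst (i 1 n x) # letters i n (snd (i 1 n x))"

lemma length_letters [simp]: "length (letters i n x) = n"
  by (induction n arbitrary: x) auto

context cartesian_system
begin

lemma fst_split_in: "x \<in> X (m + n) \<Longrightarrow> fst (i m n x) \<in> X m"
  and snd_split_in: "x \<in> X (m + n) \<Longrightarrow> snd (i m n x) \<in> X n"
  using split_in[of m n] by (auto simp: Pi_iff mem_Times_iff)

lemma letters_in_words: "x \<in> X n \<Longrightarrow> letters i n x \<in> words (X 1) n"
proof (induction n arbitrary: x)
  case 0
  then show ?case by (simp add: words_def)
next
  case (Suc n)
  then have "x \<in> X (1 + n)" by simp
  then show ?case
    using Suc.IH fst_split_in snd_split_in by (fastforce simp: words_def)
qed

lemma letters_split: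
  assumes "x \<in> X (m + n)"
  shows "letters i (m + n) x = letters i m (fst (i m n x)) @ letters i n (snd (i m n x))"
  using assms
proof (induction m arbitrary: x)
  case 0
  then show ?case by (simp add: split_left_unit)
next
  case (Suc m)
  then have x: "x \<in> X (1 + (m + n))" "x \<in> X (1 + m + n)" by simp_all
  show ?case
    \<comment> \<open>Coassociativity with \<open>l = 1\<close>: splitting the first factor of
      \<open>i (1 + m) n x\<close> by \<open>i 1 m\<close> gives the same three pieces as splitting
      off the first letter and then applying \<open>i m n\<close> to the remainder, where the
      induction hypothesis applies.\<close>
    using Suc.IH[OF snd_split_in[OF x(1)]] split_coassoc[OF x(2)]
    by (simp add: map_prod_def split_beta prod_eq_iff)
qed

lemma inj_on_letters: "inj_on (letters i n) (X n)"
proof (induction n)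
  case 0
  \<comment> \<open>\<open>letters i 0\<close> is constant, so this case rests on \<open>X 0\<close>
    being a single point.\<close>
  then show ?case by (simp add: X_0)
next
  case (Suc n)
  show ?case
  proof (rule inj_onI)
    fix x y assume "x \<in> X (Suc n)" "y \<in> X (Suc n)"
      and eq: "letters i (Suc n) x = letters i (Suc n) y"
    then have xy: "x \<in> X (1 + n)" "y \<in> X (1 + n)" by simp_all
    have "snd (i 1 n x) = snd (i 1 n y)"
      using Suc.IH eq xy[THEN snd_split_in] by (simp add: inj_on_eq_iff)
    then have "i 1 n x = i 1 n y" using eq by (simp add: prod_eq_iff)
    then show "x = y" using split_inj xy by (meson inj_onD)
  qed
qed

lemma word_system_letters: "word_system (X 1) (\<lambda>n. letters i n ` X n)"
proof
  show "letters i n ` X n \<subseteq> words (X 1) n" for n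
    using letters_in_words by blast
  show "letters i 0 ` X 0 = words (X 1) 0"
    by (auto simp: X_0 words_def)
  fix w y k
  assume "w \<in> (\<Union>n. letters i n ` X n)" and y: "y \<in> words (X 1) k" and "sublist y w"
  then obtain N x u v where x: "x \<in> X N" and w: "letters i N x = u @ y @ v"
    by (auto simp: sublist_def)
  have k: "length y = k" using y by (simp add: words_def)
  have N: "N = length u + (k + length v)"
    using arg_cong[OF w, of length] k by simp
  \<comment> \<open>A preimage of \<open>y\<close> is cut out of \<open>x\<close> in two splits:
    \<open>z\<close> drops the prefix \<open>u\<close> and so reads \<open>y @ v\<close>; the first
    factor of \<open>z\<close> at degree \<open>k\<close> then reads \<open>y\<close>.\<close>
  define z where "z = snd (i (length u) (k + length v) x)"
  have z: "z \<in> X (k + length v)"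
    using x N snd_split_in by (auto simp: z_def)
  have "letters i (k + length v) z = y @ v"
    using letters_split[of x "length u" "k + length v"] x w N by (simp add: z_def)
  then have "letters i k (fst (i k (length v) z)) = y"
    using letters_split[OF z] k by simp
  then show "y \<in> letters i k ` X k"
    using fst_split_in[OF z] by blast
qed

lemma cartesian_system_iso_letters:
  "cartesian_system_iso X \<Lambda> i (\<lambda>n. letters i n ` X n) [] (word_split (X 1)) (letters i)"
proof (intro cartesian_system_iso.intro cartesian_system_iso_axioms.intro)
  show "cartesian_system X \<Lambda> i" by (rule cartesian_system_axioms)
  show "cartesian_system (\<lambda>n. letters i n ` X n) [] (word_split (X 1))"
    using word_system_letters by (rule word_system.cartesian)
  show "bij_betw (letters i n) (X n) (letters i n ` X n)" for n
    by (simp add: bij_betw_def inj_on_letters)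
  show "word_split (X 1) m n (letters i (m + n) x) = map_prod (letters i m) (letters i n) (i m n x)"
    if "x \<in> X (m + n)" for x m n
    \<comment> \<open>The first factor reads as a word of length exactly \<open>m\<close>, so taking
      and dropping \<open>m\<close> letters recovers the two words of
      \<open>letters_split\<close>.\<close>
    using word_split_eq[OF letters_in_words[OF that]] letters_split[OF that]
    by (simp add: map_prod_def split_beta)
qed

end

theorem corollary3p16:
  fixes X :: "nat \<Rightarrow> 'a set"
    and \<Lambda> :: 'a
    and i :: "nat \<Rightarrow> nat \<Rightarrow> 'a \<Rightarrow> 'a \<times> 'a"
  assumes "cartesian_system X \<Lambda> i"
  shows "\<exists>(A :: 'a set) W. word_system A W \<and>
           cartesian_isomorphic X \<Lambda> i W [] (word_split A)"
  using cartesian_system.word_system_letters[OF assms]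
    cartesian_system.cartesian_system_iso_letters[OF assms]
  unfolding cartesian_isomorphic_def by blast

end
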